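(* Let $n\ge 1$, let $u,v$ be $n\times 1$ vectors over $Z_4$, and let $D^{(1)}$ be the $2^{(2n+3)-3}$ QC design determined by $u$ and $v$, with $\lambda_1,\ldots,\lambda_{10}$, $l_1,l_2,l_3,l_6,l_8,l_9,l_{10}$, $\rho_1,\rho_2,\xi_1,\xi_2,\xi$ as defined in the context. Then the set of all words of $D^{(1)}$ is the disjoint union of the following four classes. (a) A class of $2/\rho_1^2$ words, each with aliasing index $\rho_1$; half of these words have length $l_1+1$ and the rest have length $l_3+3$. (b) A class of $2/\rho_2^2$ words, each with aliasing index $\rho_2$ and length $l_2+1$. (c) A class consisting of one word, with aliasing index $1$ and length $l_6+2$. (d) In addition: (d1) if $\lambda_5+\lambda_6=0$, a class of $2/(\xi_1^2\xi_2^2)$ words, each with aliasing index $\xi_1\xi_2$ and length $l_8+2$; (d2) if $\lambda_5+\lambda_6>0$, a class of $2/\xi^2$ words, each with aliasing index $\xi$; half of these words have length $l_9+2$ and the rest have length $l_{10}+2$.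
   Context: $Z_4=\{0,1,2,3\}$ with arithmetic mod 4. Let $u=(u_1,\ldots,u_n)'$, $v=(v_1,\ldots,v_n)'$ be vectors over $Z_4$ (prime denotes transpose). The design $D^{(1)}$: let $C=\{(a'u,a'v,a_1,\ldots,a_n): a=(a_1,\ldots,a_n)'\in Z_4^n\}$, with $a'u,a'v$ reduced mod 4 (codewords indexed by $a\in Z_4^n$). The Gray map replaces each element of $Z_4$ by a pair: $0\to(1,1)$, $1\to(1,-1)$, $2\to(-1,-1)$, $3\to(-1,1)$. Applying it entrywise to the codewords of $C$ gives a $2^{2n}\times(2n+4)$ matrix $D$ with entries $\pm1$. $D^{(1)}$ is the $2^{2n}\times(2n+3)$ matrix obtained by deleting the first column of $D$, called a $2^{(2n+3)-3}$ QC design; rows are runs and columns are factors. Columns are distinguished by their positions, even if they coincide as vectors. Words: let $N=2^{2n}$. For a nonempty set $S$ of $k$ columns, its aliasing index is $\frac1N\left|\sum_{s=1}^N\prod_{c\in S}c_s\right|$, where $c_s$ is the $s$th entry of column $c$. If it is nonzero, $S$ is called a word of length $k$ with that aliasing index. Notation: for $0\le k,s\le3$, $f_{ks}=\#\{j:1\le j\le n,\ u_j=k,\ v_j=s\}$. Put $\lambda_1=f_{10}+f_{30}$, $\lambda_2=f_{01}+f_{03}$, $\lambda_3=f_{12}+f_{32}$, $\lambda_4=f_{21}+f_{23}$, $\lambda_5=f_{11}+f_{33}$, $\lambda_6=f_{13}+f_{31}$, $\lambda_7=f_{02}$, $\lambda_8=f_{20}$, $\lambda_9=f_{22}$, $\lambda_{10}=f_{00}$;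 $l_1=2(\lambda_4+\lambda_8+\lambda_9)+\lambda_1+\lambda_3+\lambda_5+\lambda_6$, $l_2=2(\lambda_3+\lambda_7+\lambda_9)+\lambda_2+\lambda_4+\lambda_5+\lambda_6$, $l_3=2(\lambda_2+\lambda_8+\lambda_9)+\lambda_1+\lambda_3+\lambda_5+\lambda_6$, $l_6=2(\lambda_2+\lambda_4+\lambda_5+\lambda_6)$, $l_8=2(\lambda_7+\lambda_8)+\lambda_1+\lambda_2+\lambda_3+\lambda_4$, $l_9=2(\lambda_5+\lambda_7+\lambda_8)+\lambda_1+\lambda_2+\lambda_3+\lambda_4$, $l_{10}=2(\lambda_6+\lambda_7+\lambda_8)+\lambda_1+\lambda_2+\lambda_3+\lambda_4$; and, with $\lfloor y\rfloor$ the largest integer not exceeding $y$, $\rho_1=2^{-\lfloor(\lambda_1+\lambda_3+\lambda_5+\lambda_6)/2\rfloor}$, $\rho_2=2^{-\lfloor(\lambda_2+\lambda_4+\lambda_5+\lambda_6)/2\rfloor}$, $\xi_1=2^{-\lfloor(\lambda_1+\lambda_3)/2\rfloor}$, $\xi_2=2^{-\lfloor(\lambda_2+\lambda_4)/2\rfloor}$, $\xi=2^{-\lfloor(\lambda_1+\lambda_2+\lambda_3+\lambda_4+1)/2\rfloor}$. *)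

theory Defs
  imports Complex_Main "HOL-Library.FuncSet"
begin

text \<open>
  Elements of \<open>Z\<^sub>4\<close> are the naturals \<open>0, 1, 2, 3\<close> with explicit reduction mod 4; vectors over
  \<open>Z\<^sub>4\<close> of length \<open>n\<close> are extensional functions on the positions \<open>1, \<dots>, n\<close>.
\<close>

definition Z4_vecs :: "nat \<Rightarrow> (nat \<Rightarrow> nat) set" where
  "Z4_vecs n = {1..n} \<rightarrow>\<^sub>E {0..3}"

definition Z4_inner :: "nat \<Rightarrow> (nat \<Rightarrow> nat) \<Rightarrow> (nat \<Rightarrow> nat) \<Rightarrow> nat" where
  "Z4_inner n a w = (\<Sum>j\<in>{1..n}. a j * w j) mod 4"

definition gray :: "nat \<Rightarrow> int \<times> int" where
  "gray z = (if z = 0 then (1, 1) else if z = 1 then (1, -1)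
             else if z = 2 then (-1, -1) else (-1, 1))"

context
  fixes n :: nat and u v :: "nat \<Rightarrow> nat"
begin

text \<open>
  Rows of all matrices are indexed by the vectors \<open>a \<in> Z4_vecs n\<close>; entries, coordinates and columns
  are numbered from 1.
\<close>

definition codeword :: "(nat \<Rightarrow> nat) \<Rightarrow> nat \<Rightarrow> nat" where
  "codeword a i = (if i = 1 then Z4_inner n a u else if i = 2 then Z4_inner n a v else a (i - 2))"

text \<open>Coordinate \<open>i\<close> of a codeword, \<open>1 \<le> i \<le> n + 2\<close>, yields columns \<open>2 i - 1\<close> and \<open>2 i\<close>.\<close>

definition D_full :: "(nat \<Rightarrow> nat) \<Rightarrow> nat \<Rightarrow> int" where
  "D_full a c = (let p = gray (codeword a ((c + 1) div 2)) in if odd c then fst p else snd p)"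

definition D1 :: "(nat \<Rightarrow> nat) \<Rightarrow> nat \<Rightarrow> int" where
  "D1 a c = D_full a (c + 1)"

definition D1_columns :: "nat set" where
  "D1_columns = {1..2 * n + 3}"

definition aliasing_index :: "nat set \<Rightarrow> real" where
  "aliasing_index S = real_of_int \<bar>\<Sum>a\<in>Z4_vecs n. \<Prod>c\<in>S. D1 a c\<bar> / 2 ^ (2 * n)"

text \<open>A word is a set of column positions, so its length is its cardinality.\<close>

definition D1_words :: "nat set set" where
  "D1_words = {S. S \<noteq> {} \<and> S \<subseteq> D1_columns \<and> aliasing_index S \<noteq> 0}"

definition freq :: "nat \<Rightarrow> nat \<Rightarrow> nat" where
  "freq k s = card {j \<in> {1..n}. u j = k \<and> v j = s}"

definition lam1 :: nat where "lam1 = freq 1 0 + freq 3 0"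
definition lam2 :: nat where "lam2 = freq 0 1 + freq 0 3"
definition lam3 :: nat where "lam3 = freq 1 2 + freq 3 2"
definition lam4 :: nat where "lam4 = freq 2 1 + freq 2 3"
definition lam5 :: nat where "lam5 = freq 1 1 + freq 3 3"
definition lam6 :: nat where "lam6 = freq 1 3 + freq 3 1"
definition lam7 :: nat where "lam7 = freq 0 2"
definition lam8 :: nat where "lam8 = freq 2 0"
definition lam9 :: nat where "lam9 = freq 2 2"
definition lam10 :: nat where "lam10 = freq 0 0"

definition ell1 :: nat where
  "ell1 = 2 * (lam4 + lam8 + lam9) + lam1 + lam3 + lam5 + lam6"
definition ell2 :: nat where
  "ell2 = 2 * (lam3 + lam7 + lam9) + lam2 + lam4 + lam5 + lam6"
definition ell3 :: nat where
  "ell3 = 2 * (lam2 + lam8 + lam9) + lam1 + lam3 + lam5 + lam6"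
definition ell6 :: nat where
  "ell6 = 2 * (lam2 + lam4 + lam5 + lam6)"
definition ell8 :: nat where
  "ell8 = 2 * (lam7 + lam8) + lam1 + lam2 + lam3 + lam4"
definition ell9 :: nat where
  "ell9 = 2 * (lam5 + lam7 + lam8) + lam1 + lam2 + lam3 + lam4"
definition ell10 :: nat where
  "ell10 = 2 * (lam6 + lam7 + lam8) + lam1 + lam2 + lam3 + lam4"

definition rho1 :: real where "rho1 = 1 / 2 ^ ((lam1 + lam3 + lam5 + lam6) div 2)"
definition rho2 :: real where "rho2 = 1 / 2 ^ ((lam2 + lam4 + lam5 + lam6) div 2)"
definition xi1 :: real where "xi1 = 1 / 2 ^ ((lam1 + lam3) div 2)"
definition xi2 :: real where "xi2 = 1 / 2 ^ ((lam2 + lam4) div 2)"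
definition xi :: real where "xi = 1 / 2 ^ ((lam1 + lam2 + lam3 + lam4 + 1) div 2)"

end

text \<open>
  Half of the sets in \<open>W\<close> have size \<open>p\<close> and the rest size \<open>q\<close>; the case \<open>p = q\<close> is not excluded.
\<close>

definition half_lengths :: "nat set set \<Rightarrow> nat \<Rightarrow> nat \<Rightarrow> bool" where
  "half_lengths W p q \<longleftrightarrow> (\<exists>H \<subseteq> W. 2 * card H = card W \<and>
     (\<forall>S\<in>H. card S = p) \<and> (\<forall>S\<in>W - H. card S = q))"

end

theory Submission
  imports Defs
begin

text \<open>
  Columns \<open>4, 5, \<dots>\<close> of the design carry the information coordinates: their products form an orthonormal
  basis of the functions on \<open>Z\<^sub>4\<^sup>n\<close>. Write a set of columns as \<open>H \<union> T\<close> with \<open>H \<subseteq> {1, 2, 3}\<close> and \<open>T\<close>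
  among these. The aliasing index of \<open>H \<union> T\<close> is then the absolute value of the \<open>T\<close>-th coefficient of the
  product of the columns in \<open>H\<close>. The Gray map is \<open>k \<mapsto> (Re ((1 - \<i>) \<i>\<^sup>k), Re ((1 + \<i>) \<i>\<^sup>k))\<close>, so this product
  is the real part of a combination of at most two characters of \<open>Z\<^sub>4\<^sup>n\<close>, given by \<open>u\<close>, \<open>v\<close>, \<open>2v\<close>,
  \<open>u + 2v\<close> or \<open>u \<plusminus> v\<close>. The coefficients of the character of \<open>w\<close> factor over the positions: they
  vanish unless \<open>T\<close> contains no, both or exactly one of the columns of position \<open>j\<close> according to
  \<open>w\<^sub>j = 0\<close>, \<open>w\<^sub>j = 2\<close> or \<open>w\<^sub>j\<close> odd, which gives the lengths, and are otherwise products of factors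
  \<open>(1 \<plusminus> \<i>) / 2\<close>, which gives the indices. Since the nonzero indices for a fixed \<open>H\<close> are all equal to
  some \<open>r\<close>, Parseval shows that there are exactly \<open>1 / r\<^sup>2\<close> of them.
\<close>

subsection \<open>Fourier coefficients of products of free columns\<close>

definition free_columns :: "nat \<Rightarrow> nat set" where
  "free_columns n = {4..2 * n + 3}"

text \<open>With the first column deleted, position \<open>j\<close> owns columns
  \<open>2 * j + 2\<close> and \<open>2 * j + 3\<close>, so the even column is the first Gray
  component.\<close>

definition free_entry :: "(nat \<Rightarrow> nat) \<Rightarrow> nat \<Rightarrow> int" where
  "free_entry a c = (if even c then fst else snd) (gray (a (c div 2 - 1)))"

text \<open>The exponent is left unreduced because \<open>\<i>\<close> has order 4. Hence
  \<open>w\<close> may have entries above 3, such as \<open>u j + 3 * v j\<close>, which stands for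
  \<open>u j - v j\<close>.\<close>

definition Z4_char :: "nat \<Rightarrow> (nat \<Rightarrow> nat) \<Rightarrow> (nat \<Rightarrow> nat) \<Rightarrow> complex" where
  "Z4_char n w a = \<i> ^ (\<Sum>j\<in>{1..n}. a j * w j)"

definition four_coeff :: "nat \<Rightarrow> (nat \<Rightarrow> nat) \<Rightarrow> nat set \<Rightarrow> complex" where
  "four_coeff n w T =
    (\<Sum>a\<in>Z4_vecs n. Z4_char n w a * of_int (\<Prod>c\<in>T. free_entry a c)) / 4 ^ n"

text \<open>The factor of \<open>four_coeff\<close> at one position; \<open>b\<close> and
  \<open>b'\<close> tell whether \<open>T\<close> contains the first and the second column of that
  position.\<close>

definition local_coeff :: "bool \<Rightarrow> bool \<Rightarrow> nat \<Rightarrow> complex" where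
  "local_coeff b b' k = (\<Sum>z\<in>{0..3}. \<i> ^ (z * k) *
     of_int ((if b then fst (gray z) else 1) * (if b' then snd (gray z) else 1))) / 4"

lemma finite_Z4_vecs [simp]: "finite (Z4_vecs n)"
  by (simp add: Z4_vecs_def finite_PiE)

lemma card_Z4_vecs: "card (Z4_vecs n) = 4 ^ n"
  by (simp add: Z4_vecs_def card_PiE)

lemma prod_free_columns:
  fixes f :: "nat \<Rightarrow> 'a::comm_monoid_mult"
  shows "(\<Prod>c\<in>free_columns n. f c) = (\<Prod>j\<in>{1..n}. f (2 * j + 2) * f (2 * j + 3))"
proof (induction n)
  case (Suc n)
  have "free_columns (Suc n) = insert (2 * n + 5) (insert (2 * n + 4) (free_columns n))"
    by (auto simp: free_columns_def)
  then show ?case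
    using Suc by (simp add: free_columns_def mult_ac numeral_eq_Suc)
qed (simp add: free_columns_def)

lemma sum_free_columns:
  fixes f :: "nat \<Rightarrow> 'a::comm_monoid_add"
  shows "(\<Sum>c\<in>free_columns n. f c) = (\<Sum>j\<in>{1..n}. f (2 * j + 2) + f (2 * j + 3))"
proof (induction n)
  case (Suc n)
  have "free_columns (Suc n) = insert (2 * n + 5) (insert (2 * n + 4) (free_columns n))"
    by (auto simp: free_columns_def)
  then show ?case
    using Suc by (simp add: free_columns_def add_ac numeral_eq_Suc)
qed (simp add: free_columns_def)

lemma power_i_mod4: "\<i> ^ k = \<i> ^ (k mod 4)"
proof -
  have "\<i> ^ k = \<i> ^ (4 * (k div 4) + k mod 4)" by simp
  also have "\<dots> = \<i> ^ (k mod 4)" unfolding power_add power_mult by simp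
  finally show ?thesis .
qed

lemma Z4_cases:
  fixes k :: nat
  obtains "k mod 4 = 0" | "k mod 4 = 1" | "k mod 4 = 2" | "k mod 4 = 3"
  by linarith

lemma even_iff_mod4: "even k \<longleftrightarrow> k mod 4 = 0 \<or> k mod 4 = (2::nat)"
  by presburger

lemma local_coeff_mod4: "local_coeff b b' k = local_coeff b b' (k mod 4)"
proof -
  have "\<i> ^ (z * k) = \<i> ^ (z * (k mod 4))" for z
    by (metis power_i_mod4 mod_mult_right_eq)
  then show ?thesis
    unfolding local_coeff_def by simp
qed

lemma atLeastAtMost_0_3: "{0..3::nat} = {0, 1, 2, 3}"
  by auto

text \<open>On a single coordinate, the empty product is the trivial character, the product of both
  Gray components is the character of order 2, and each component alone combines the two characters
  of order 4. Hence even \<open>k\<close> sees only none or both, and odd \<open>k\<close> only one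
  of the two.\<close>

lemma local_coeff_0_3:
  "local_coeff b b' 0 = of_bool (\<not> b \<and> \<not> b')"
  "local_coeff b b' 1 = (if b = b' then 0 else if b then (1 + \<i>) / 2 else (1 - \<i>) / 2)"
  "local_coeff b b' 2 = of_bool (b \<and> b')"
  "local_coeff b b' 3 = (if b = b' then 0 else if b then (1 - \<i>) / 2 else (1 + \<i>) / 2)"
  unfolding local_coeff_def atLeastAtMost_0_3
  by (cases b; cases b'; simp add: gray_def complex_eq_iff power_i_mod4[of 6] power_i_mod4[of 9] power_i_mod4[of 3] power3_eq_cube)+

lemma local_coeff_eq:
  "local_coeff b b' k =
    (if even k then of_bool (b = b' \<and> b = (k mod 4 = 2))
     else if b = b' then 0
     else if b = (k mod 4 = 1) then (1 + \<i>) / 2 else (1 - \<i>) / 2)"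
  by (subst local_coeff_mod4, cases k rule: Z4_cases)
    (auto simp: local_coeff_0_3 even_iff_mod4 simp del: One_nat_def)

lemma free_entry_pair:
  "free_entry a (2 * j + 2) = fst (gray (a j))" "free_entry a (2 * j + 3) = snd (gray (a j))"
  by (simp_all add: free_entry_def)

text \<open>Character and columns both factor over the coordinates of \<open>a\<close>, so the sum
  over all vectors is a product of sums over single coordinates.\<close>

lemma four_coeff_eq_prod:
  assumes "T \<subseteq> free_columns n"
  shows "four_coeff n w T =
    (\<Prod>j\<in>{1..n}. local_coeff (2 * j + 2 \<in> T) (2 * j + 3 \<in> T) (w j))"
proof -
  have *: "(\<Prod>c\<in>T. free_entry a c) = (\<Prod>j\<in>{1..n}.
      (if 2 * j + 2 \<in> T then fst (gray (a j)) else 1) *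
      (if 2 * j + 3 \<in> T then snd (gray (a j)) else 1))" for a
  proof -
    \<comment> \<open>Columns outside \<open>T\<close> are filled in with the factor 1, so that the
      product can be grouped by positions.\<close>
    have "(\<Prod>c\<in>T. free_entry a c) = (\<Prod>c\<in>free_columns n. if c \<in> T then free_entry a c else 1)"
      using assms by (simp add: prod.If_cases free_columns_def Int_absorb1)
    also have "\<dots> = (\<Prod>j\<in>{1..n}.
      (if 2 * j + 2 \<in> T then free_entry a (2 * j + 2) else 1) *
      (if 2 * j + 3 \<in> T then free_entry a (2 * j + 3) else 1))"
      by (rule prod_free_columns)
    finally show ?thesis
      by (simp only: free_entry_pair)
  qed
  show ?thesis
    unfolding four_coeff_def local_coeff_def prod_dividef prod_constant * Z4_char_def power_sum Z4_vecs_def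
    by (simp add: prod_sum_PiE prod.distrib[symmetric])
qed

subsection \<open>Values of the coefficients\<close>

text \<open>The two cases are the normalised products of \<open>m\<close> factors \<open>(1 \<plusminus> \<i>) / 2\<close>: they lie on the axes
  for even \<open>m\<close> and on the diagonals for odd \<open>m\<close>.\<close>
definition octagonal :: "nat \<Rightarrow> complex \<Rightarrow> bool" where
  "octagonal m z \<longleftrightarrow> (let r = 1 / 2 ^ ((m + 1) div 2) in
     if even m then \<bar>Re z\<bar> = r \<and> Im z = 0 \<or> Re z = 0 \<and> \<bar>Im z\<bar> = r
     else \<bar>Re z\<bar> = r \<and> \<bar>Im z\<bar> = r)"

text \<open>Multiplication by \<open>(1 \<plusminus> \<i>) / 2\<close> turns by 45 degrees and
  shrinks by the square root of 2, so it exchanges axes and diagonals. The size of the nonzero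
  coordinates is halved on leaving the axes and kept on returning to them.\<close>

lemma octagonal_Suc:
  assumes "octagonal m z" "x = (1 + \<i>) / 2 \<or> x = (1 - \<i>) / 2"
  shows "octagonal (Suc m) (x * z)"
proof -
  define p q where "p = Re (x * z)" and "q = Im (x * z)"
  have pq: "p = (Re z - Im z) / 2 \<and> q = (Re z + Im z) / 2 \<or>
      p = (Re z + Im z) / 2 \<and> q = (Im z - Re z) / 2"
    using assms(2) unfolding p_def q_def by (elim disjE; hypsubst) (simp_all add: field_simps)
  show ?thesis
  proof (cases "even m")
    case True
    then have "(Suc m + 1) div 2 = Suc ((m + 1) div 2)"
      by auto
    then show ?thesis
      using assms(1) True pq unfolding octagonal_def Let_def p_def[symmetric] q_def[symmetric]
      by auto
  next
    case False
    define r :: real where "r = 1 / 2 ^ ((m + 1) div 2)"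
    have "(Suc m + 1) div 2 = (m + 1) div 2"
      using False by presburger
    then have r: "1 / 2 ^ ((Suc m + 1) div 2) = r"
      by (simp only: r_def)
    have "Re z \<in> {r, -r}" "Im z \<in> {r, -r}"
      using assms(1) False by (auto simp: octagonal_def Let_def r_def abs_if split: if_splits)
    moreover have "\<bar>r\<bar> = r"
      by (simp add: r_def)
    ultimately show ?thesis
      using False pq unfolding octagonal_def Let_def p_def[symmetric] q_def[symmetric] r
      by auto
  qed
qed

text \<open>A nonzero factor is 1 at an even entry and \<open>(1 \<plusminus> \<i>) / 2\<close> at
  an odd one, so only the odd entries count.\<close>

lemma octagonal_prod_local_coeff:
  assumes "finite J" "\<And>j. j \<in> J \<Longrightarrow> local_coeff (b j) (b' j) (w j) \<noteq> 0"
  shows "octagonal (card {j \<in> J. odd (w j)}) (\<Prod>j\<in>J. local_coeff (b j) (b' j) (w j))"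
  using assms
proof (induction J rule: finite_induct)
  case empty
  then show ?case by (simp add: octagonal_def)
next
  case (insert i J)
  let ?P = "\<Prod>j\<in>J. local_coeff (b j) (b' j) (w j)"
  have IH: "octagonal (card {j \<in> J. odd (w j)}) ?P"
    using insert by simp
  have nz: "local_coeff (b i) (b' i) (w i) \<noteq> 0"
    using insert by simp
  show ?case
  proof (cases "even (w i)")
    case True
    then have "{j \<in> insert i J. odd (w j)} = {j \<in> J. odd (w j)}"
      by auto
    moreover have "local_coeff (b i) (b' i) (w i) = 1"
      using nz True by (auto simp: local_coeff_eq split: if_splits)
    ultimately show ?thesis
      using IH insert by simp
  next
    case False
    then have "{j \<in> insert i J. odd (w j)} = insert i {j \<in> J. odd (w j)}"
      by auto
    moreover have "local_coeff (b i) (b' i) (w i) = (1 + \<i>) / 2 \<or>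
        local_coeff (b i) (b' i) (w i) = (1 - \<i>) / 2"
      using nz False by (simp add: local_coeff_eq split: if_splits)
    ultimately show ?thesis
      using octagonal_Suc[OF IH] insert by simp
  qed
qed

lemma octagonal_Re: "octagonal m z \<Longrightarrow> \<bar>Re z\<bar> \<in> {0, 1 / 2 ^ ((m + 1) div 2)}"
  and octagonal_Im: "octagonal m z \<Longrightarrow> \<bar>Im z\<bar> \<in> {0, 1 / 2 ^ ((m + 1) div 2)}"
  by (auto simp: octagonal_def Let_def split: if_splits)

text \<open>Half of \<open>x\<close> is one more factor of the octagonal product. Undoing the
  halving turns the exponent \<open>(m + 2) div 2\<close> into \<open>m div 2\<close>, the exponent
  in \<open>rho1\<close> and \<open>rho2\<close>.\<close>

lemma octagonal_Re_unit:
  assumes "octagonal m z" "x = 1 + \<i> \<or> x = 1 - \<i>"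
  shows "\<bar>Re (x * z)\<bar> \<in> {0, 1 / 2 ^ (m div 2)}"
proof -
  have "octagonal (Suc m) (x / 2 * z)"
    using assms by (intro octagonal_Suc) auto
  from octagonal_Re[OF this] show ?thesis
    by auto
qed

text \<open>The left side is the number of columns that a set with nonzero coefficient has at one
  position; this is how a character fixes the word length.\<close>

lemma local_coeff_nonzero:
  assumes "local_coeff b b' k \<noteq> 0"
  shows "of_bool b + of_bool b' = (of_bool (odd k) + 2 * of_bool (k mod 4 = 2) :: nat)"
  using assms by (cases k rule: Z4_cases) (auto simp: local_coeff_eq even_iff_mod4 split: if_splits)

text \<open>A nonzero product has only nonzero factors; each of them then has a known shape and a
  known number of columns, and both are collected over the positions.\<close>

lemma
  assumes "T \<subseteq> free_columns n" "four_coeff n w T \<noteq> 0"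
  shows octagonal_four_coeff: "octagonal (card {j \<in> {1..n}. odd (w j)}) (four_coeff n w T)"
    and card_of_four_coeff_nonzero:
      "card T = card {j \<in> {1..n}. odd (w j)} + 2 * card {j \<in> {1..n}. w j mod 4 = 2}"
proof -
  have nz: "local_coeff (2 * j + 2 \<in> T) (2 * j + 3 \<in> T) (w j) \<noteq> 0" if "j \<in> {1..n}" for j
    using assms that by (auto simp: four_coeff_eq_prod)
  then show "octagonal (card {j \<in> {1..n}. odd (w j)}) (four_coeff n w T)"
    unfolding four_coeff_eq_prod[OF assms(1)] by (intro octagonal_prod_local_coeff) auto
  have "card T = (\<Sum>c\<in>free_columns n. of_bool (c \<in> T))"
    using assms(1) by (simp add: free_columns_def Int_absorb1 flip: sum.inter_filter)
  also have "\<dots> = (\<Sum>j\<in>{1..n}. of_bool (2 * j + 2 \<in> T) + of_bool (2 * j + 3 \<in> T))"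
    by (rule sum_free_columns)
  also have "\<dots> = (\<Sum>j\<in>{1..n}. of_bool (odd (w j)) + 2 * of_bool (w j mod 4 = 2))"
    by (intro sum.cong refl local_coeff_nonzero nz)
  also have "\<dots> = card {j \<in> {1..n}. odd (w j)} + 2 * card {j \<in> {1..n}. w j mod 4 = 2}"
    by (simp add: sum.distrib Int_def flip: sum_distrib_left)
  finally show "card T = card {j \<in> {1..n}. odd (w j)} + 2 * card {j \<in> {1..n}. w j mod 4 = 2}" .
qed

subsection \<open>Parseval identity\<close>

text \<open>The real counterpart of \<open>four_coeff\<close>: the coefficient of an arbitrary real
  function at the basis element indexed by \<open>T\<close>.\<close>

definition walsh_coeff :: "nat \<Rightarrow> ((nat \<Rightarrow> nat) \<Rightarrow> real) \<Rightarrow> nat set \<Rightarrow> real" where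
  "walsh_coeff n f T = (\<Sum>a\<in>Z4_vecs n. f a * of_int (\<Prod>c\<in>T. free_entry a c)) / 4 ^ n"

lemma gray_inject: "x \<le> 3 \<Longrightarrow> y \<le> 3 \<Longrightarrow> gray x = gray y \<Longrightarrow> x = y"
  by (auto simp: gray_def split: if_splits)

lemma gray_unit:
  "fst (gray x) \<in> {1, -1}" "snd (gray x) \<in> {1, -1}"
  by (auto simp: gray_def)

text \<open>Each of the \<open>2 * n\<close> factors is 2 on the diagonal. Off the diagonal,
  injectivity of the Gray map provides a column in which \<open>a\<close> and \<open>b\<close> have
  opposite signs, and its factor vanishes.\<close>

lemma walsh_kernel:
  assumes "a \<in> Z4_vecs n" "b \<in> Z4_vecs n"
  shows "(\<Prod>c\<in>free_columns n. 1 + free_entry a c * free_entry b c) = (if a = b then 4 ^ n else 0)"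
proof (cases "a = b")
  case True
  have "free_entry a c * free_entry a c = 1" for c
    using gray_unit[of "a (c div 2 - 1)"] by (auto simp: free_entry_def)
  then show ?thesis
    using True by (simp add: free_columns_def power_mult)
next
  case False
  then obtain j where j: "j \<in> {1..n}" "a j \<noteq> b j"
    using assms unfolding Z4_vecs_def by (meson PiE_ext)
  then have "gray (a j) \<noteq> gray (b j)"
    using assms by (auto simp: Z4_vecs_def PiE_def Pi_def dest: gray_inject)
  then have "1 + fst (gray (a j)) * fst (gray (b j)) = 0 \<or> 1 + snd (gray (a j)) * snd (gray (b j)) = 0"
    using gray_unit[of "a j"] gray_unit[of "b j"] by (auto simp: prod_eq_iff)
  then have "\<exists>i\<in>{1..n}. (1 + fst (gray (a i)) * fst (gray (b i))) * (1 + snd (gray (a i)) * snd (gray (b i))) = 0"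
    using j(1) by (intro bexI[of _ j]) auto
  then show ?thesis
    using False unfolding prod_free_columns free_entry_pair by (subst prod_zero) auto
qed

lemma sum_walsh_coeff_square:
  "(\<Sum>T\<in>Pow (free_columns n). (walsh_coeff n f T)\<^sup>2) = (\<Sum>a\<in>Z4_vecs n. (f a)\<^sup>2) / 4 ^ n"
proof -
  let ?R = "\<lambda>T a. \<Prod>c\<in>T. free_entry a c"
  have kernel: "(\<Sum>T\<in>Pow (free_columns n). ?R T a * ?R T b) = (if a = b then 4 ^ n else 0)"
    if "a \<in> Z4_vecs n" "b \<in> Z4_vecs n" for a b
    \<comment> \<open>Expanding the kernel over subsets yields the sum over \<open>T\<close>; the
      columns outside \<open>T\<close> contribute 1.\<close>
    using prod_add[of "free_columns n" "\<lambda>c. free_entry a c * free_entry b c" "\<lambda>_. 1"]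
    unfolding walsh_kernel[OF that, symmetric]
    by (simp add: prod.distrib add.commute free_columns_def)
  have "(\<Sum>T\<in>Pow (free_columns n). (walsh_coeff n f T * 4 ^ n)\<^sup>2) =
    (\<Sum>T\<in>Pow (free_columns n). \<Sum>a\<in>Z4_vecs n. \<Sum>b\<in>Z4_vecs n.
      f a * f b * of_int (?R T a * ?R T b))"
    by (simp add: walsh_coeff_def power2_eq_square sum_product mult_ac)
  also have "\<dots> = (\<Sum>a\<in>Z4_vecs n. \<Sum>b\<in>Z4_vecs n. \<Sum>T\<in>Pow (free_columns n).
      f a * f b * of_int (?R T a * ?R T b))"
    by (subst sum.swap, rule sum.cong[OF refl], rule sum.swap)
  also have "\<dots> = (\<Sum>a\<in>Z4_vecs n. \<Sum>b\<in>Z4_vecs n. f a * f b * of_int (if a = b then 4 ^ n else 0))"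
    by (intro sum.cong refl) (simp only: kernel flip: of_int_sum sum_distrib_left)
  also have "\<dots> = (\<Sum>a\<in>Z4_vecs n. (f a)\<^sup>2) * 4 ^ n"
    by (simp add: if_distrib sum_distrib_right power2_eq_square cong: if_cong)
  finally have "(\<Sum>T\<in>Pow (free_columns n). (walsh_coeff n f T)\<^sup>2) * (4 ^ n)\<^sup>2 =
      (\<Sum>a\<in>Z4_vecs n. (f a)\<^sup>2) * 4 ^ n"
    by (simp add: power_mult_distrib sum_distrib_right)
  then show ?thesis
    by (simp add: field_simps power2_eq_square)
qed

text \<open>If all nonzero coefficients have the same modulus, the Parseval sum counts them.\<close>

lemma card_walsh_coeff_nonzero:
  fixes r :: real
  assumes "\<And>T. T \<subseteq> free_columns n \<Longrightarrow> \<bar>walsh_coeff n f T\<bar> \<in> {0, r}"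
  shows "card {T. T \<subseteq> free_columns n \<and> walsh_coeff n f T \<noteq> 0} * r\<^sup>2 =
    (\<Sum>a\<in>Z4_vecs n. (f a)\<^sup>2) / 4 ^ n"
proof -
  have *: "(walsh_coeff n f T)\<^sup>2 = (if walsh_coeff n f T \<noteq> 0 then r\<^sup>2 else 0)"
    if "T \<in> Pow (free_columns n)" for T
  proof (cases "walsh_coeff n f T = 0")
    case False
    then have "\<bar>walsh_coeff n f T\<bar> = r"
      using assms[of T] that by auto
    then show ?thesis
      using False power2_abs[of "walsh_coeff n f T"] by simp
  qed simp
  have "(\<Sum>a\<in>Z4_vecs n. (f a)\<^sup>2) / 4 ^ n =
      (\<Sum>T\<in>Pow (free_columns n). if walsh_coeff n f T \<noteq> 0 then r\<^sup>2 else 0)"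
    unfolding sum_walsh_coeff_square[symmetric] by (intro sum.cong refl *)
  also have "\<dots> = card {T. T \<subseteq> free_columns n \<and> walsh_coeff n f T \<noteq> 0} * r\<^sup>2"
    by (simp add: sum.If_cases free_columns_def Int_def Pow_def)
  finally show ?thesis ..
qed

text \<open>The columns are real, so taking real parts commutes with forming coefficients.\<close>

lemma walsh_coeff_Re: "walsh_coeff n (\<lambda>a. Re (x * Z4_char n w a)) T = Re (x * four_coeff n w T)"
proof -
  have "x * four_coeff n w T =
      (\<Sum>a\<in>Z4_vecs n. x * Z4_char n w a * of_int (\<Prod>c\<in>T. free_entry a c)) / of_real (4 ^ n)"
    by (simp add: four_coeff_def sum_distrib_left mult.assoc)
  then show ?thesis
    unfolding walsh_coeff_def Re_divide_of_real by (simp only: Re_sum times_complex.sel) (simp del: of_int_prod)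
qed

lemma walsh_coeff_add: "walsh_coeff n (\<lambda>a. f a + g a) T = walsh_coeff n f T + walsh_coeff n g T"
  by (simp add: walsh_coeff_def sum.distrib distrib_right add_divide_distrib)

subsection \<open>Words with a given set of leading columns\<close>

lemma gray_eq_Re:
  "of_int (fst (gray (k mod 4))) = Re ((1 - \<i>) * \<i> ^ k)"
  "of_int (snd (gray (k mod 4))) = Re ((1 + \<i>) * \<i> ^ k)"
  by (subst power_i_mod4, cases k rule: Z4_cases; simp add: gray_def power3_eq_cube)+

lemma Z4_char_lincomb:
  "Z4_char n (\<lambda>j. p * u j + q * v j) a = Z4_char n u a ^ p * Z4_char n v a ^ q"
  by (simp add: Z4_char_def sum.distrib sum_distrib_left distrib_left power_add power_mult mult_ac
      flip: power_mult)

lemma Z4_char_cases: "Z4_char n w a \<in> {1, \<i>, -1, -\<i>}"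
  unfolding Z4_char_def
  by (subst power_i_mod4, cases "\<Sum>j\<in>{1..n}. a j * w j" rule: Z4_cases; simp add: power3_eq_cube)

text \<open>Column 1 is the second Gray component of the inner product with \<open>u\<close>, the
  first being deleted; columns 2 and 3 are the two components of the inner product with
  \<open>v\<close>.\<close>

lemma D1_head:
  "of_int (D1 n u v a 1) = Re ((1 + \<i>) * Z4_char n u a)"
  "of_int (D1 n u v a 2) = Re ((1 - \<i>) * Z4_char n v a)"
  "of_int (D1 n u v a 3) = Re ((1 + \<i>) * Z4_char n v a)"
  unfolding Z4_char_def gray_eq_Re[symmetric]
  by (simp_all add: D1_def D_full_def codeword_def Z4_inner_def Let_def)

lemma D1_free: "4 \<le> c \<Longrightarrow> D1 n u v a c = free_entry a c"
  by (auto simp: D1_def D_full_def codeword_def free_entry_def Let_def elim!: evenE oddE)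

definition head :: "nat \<Rightarrow> (nat \<Rightarrow> nat) \<Rightarrow> (nat \<Rightarrow> nat) \<Rightarrow> nat set \<Rightarrow> (nat \<Rightarrow> nat) \<Rightarrow> real" where
  "head n u v H a = of_int (\<Prod>c\<in>H. D1 n u v a c)"

lemma D1_square: "D1 n u v a c * D1 n u v a c = 1"
  by (simp add: D1_def D_full_def Let_def gray_def)

lemma head_square: "(head n u v H a)\<^sup>2 = 1"
  by (simp add: head_def power2_eq_square D1_square flip: of_int_mult prod.distrib)

text \<open>The trivial factors \<open>0 *\<close> and \<open>1 *\<close> keep all characters in the shape of \<open>Z4_char_lincomb\<close>.\<close>
lemma head_eq:
  "head n u v {} a = Re (1 * Z4_char n (\<lambda>j. 0) a)"
  "head n u v {1} a = Re ((1 + \<i>) * Z4_char n u a)"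
  "head n u v {2} a = Re ((1 - \<i>) * Z4_char n v a)"
  "head n u v {3} a = Re ((1 + \<i>) * Z4_char n v a)"
  "head n u v {2, 3} a = Re (1 * Z4_char n (\<lambda>j. 0 * u j + 2 * v j) a)"
  "head n u v {1, 2, 3} a = Re ((1 + \<i>) * Z4_char n (\<lambda>j. 1 * u j + 2 * v j) a)"
  "head n u v {1, 2} a = Re (1 * Z4_char n (\<lambda>j. 1 * u j + 1 * v j) a) +
    Re (\<i> * Z4_char n (\<lambda>j. 1 * u j + 3 * v j) a)"
  "head n u v {1, 3} a = Re (\<i> * Z4_char n (\<lambda>j. 1 * u j + 1 * v j) a) +
    Re (1 * Z4_char n (\<lambda>j. 1 * u j + 3 * v j) a)"
proof -
  show "head n u v {} a = Re (1 * Z4_char n (\<lambda>j. 0) a)"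
    by (simp add: head_def Z4_char_def)
  show "head n u v {1} a = Re ((1 + \<i>) * Z4_char n u a)"
    "head n u v {2} a = Re ((1 - \<i>) * Z4_char n v a)"
    "head n u v {3} a = Re ((1 + \<i>) * Z4_char n v a)"
    by (simp_all only: head_def D1_head prod.insert finite.intros prod.empty of_int_mult empty_iff not_False_eq_True of_int_1 mult_1_right)
  have mult: "head n u v {1, 2} a = of_int (D1 n u v a 1) * of_int (D1 n u v a 2)"
    "head n u v {1, 3} a = of_int (D1 n u v a 1) * of_int (D1 n u v a 3)"
    "head n u v {2, 3} a = of_int (D1 n u v a 2) * of_int (D1 n u v a 3)"
    "head n u v {1, 2, 3} a = of_int (D1 n u v a 1) * of_int (D1 n u v a 2) * of_int (D1 n u v a 3)"
    by (simp_all add: head_def)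
  show "head n u v {2, 3} a = Re (1 * Z4_char n (\<lambda>j. 0 * u j + 2 * v j) a)"
  "head n u v {1, 2, 3} a = Re ((1 + \<i>) * Z4_char n (\<lambda>j. 1 * u j + 2 * v j) a)"
  "head n u v {1, 2} a = Re (1 * Z4_char n (\<lambda>j. 1 * u j + 1 * v j) a) +
    Re (\<i> * Z4_char n (\<lambda>j. 1 * u j + 3 * v j) a)"
  "head n u v {1, 3} a = Re (\<i> * Z4_char n (\<lambda>j. 1 * u j + 1 * v j) a) +
    Re (1 * Z4_char n (\<lambda>j. 1 * u j + 3 * v j) a)"
    unfolding mult D1_head Z4_char_lincomb
    \<comment> \<open>Each character takes only four values, so the product formulas reduce to
      sixteen numerical cases.\<close>
    using Z4_char_cases[of n u a] Z4_char_cases[of n v a]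
    by (elim insertE emptyE; simp add: power3_eq_cube)+
qed

lemma heads_free_disjoint: "{1, 2, 3} \<inter> free_columns n = {}"
  by (auto simp: free_columns_def)

lemma aliasing_index_Un:
  assumes "H \<subseteq> {1, 2, 3}" "T \<subseteq> free_columns n"
  shows "aliasing_index n u v (H \<union> T) = \<bar>walsh_coeff n (head n u v H) T\<bar>"
proof -
  have fin: "finite H" "finite T"
    using assms by (auto intro: finite_subset simp: free_columns_def)
  have disj: "H \<inter> T = {}"
    using assms heads_free_disjoint[of n] by blast
  have "(\<Prod>c\<in>T. D1 n u v a c) = (\<Prod>c\<in>T. free_entry a c)" for a
    using assms(2) by (intro prod.cong refl D1_free) (auto simp: free_columns_def)
  then have "(\<Prod>c\<in>H \<union> T. D1 n u v a c) = (\<Prod>c\<in>H. D1 n u v a c) * (\<Prod>c\<in>T. free_entry a c)" for a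
    using fin disj by (simp add: prod.union_disjoint)
  then have "aliasing_index n u v (H \<union> T) =
      \<bar>\<Sum>a\<in>Z4_vecs n. head n u v H a * of_int (\<Prod>c\<in>T. free_entry a c)\<bar> / 4 ^ n"
    unfolding aliasing_index_def head_def power_mult by (simp del: of_int_prod flip: of_int_mult of_int_sum)
  then show ?thesis
    by (simp add: walsh_coeff_def)
qed

section \<open>Decomposition of the words by their leading columns\<close>

definition head_words :: "nat \<Rightarrow> (nat \<Rightarrow> nat) \<Rightarrow> (nat \<Rightarrow> nat) \<Rightarrow> nat set \<Rightarrow> nat set set" where
  "head_words n u v H = {S \<in> D1_words n u v. S \<inter> {1, 2, 3} = H}"

lemma D1_columns_split: "D1_columns n = {1, 2, 3} \<union> free_columns n"
  by (auto simp: D1_columns_def free_columns_def)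

text \<open>The last condition excludes the empty set, which arises from \<open>H = {}\<close> with
  coefficient 1 but is not a word.\<close>

lemma head_words_image:
  assumes "H \<subseteq> {1, 2, 3}"
  shows "head_words n u v H =
    (\<union>) H ` {T. T \<subseteq> free_columns n \<and> walsh_coeff n (head n u v H) T \<noteq> 0 \<and> H \<union> T \<noteq> {}}"
proof (intro equalityI subsetI)
  fix S assume S: "S \<in> head_words n u v H"
  define T where "T = S \<inter> free_columns n"
  have T: "T \<subseteq> free_columns n" "S = H \<union> T" "S \<noteq> {}"
    using S by (auto simp: head_words_def D1_words_def D1_columns_split T_def)
  moreover have "walsh_coeff n (head n u v H) T \<noteq> 0"
    using aliasing_index_Un[OF assms T(1), of u v] S
    unfolding T(2)[symmetric] by (auto simp: head_words_def D1_words_def)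
  ultimately show "S \<in> (\<union>) H ` {T. T \<subseteq> free_columns n \<and> walsh_coeff n (head n u v H) T \<noteq> 0 \<and> H \<union> T \<noteq> {}}"
    by blast
next
  fix S assume "S \<in> (\<union>) H ` {T. T \<subseteq> free_columns n \<and> walsh_coeff n (head n u v H) T \<noteq> 0 \<and> H \<union> T \<noteq> {}}"
  then obtain T where T: "T \<subseteq> free_columns n" "walsh_coeff n (head n u v H) T \<noteq> 0"
    "S = H \<union> T" "S \<noteq> {}" by auto
  have "S \<subseteq> D1_columns n" "S \<inter> {1, 2, 3} = H"
    using T(1,3) assms heads_free_disjoint[of n] unfolding D1_columns_split by blast+
  then show "S \<in> head_words n u v H"
    using aliasing_index_Un[OF assms T(1), of u v] T by (simp add: head_words_def D1_words_def)
qed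

lemma head_wordsE:
  assumes "S \<in> head_words n u v H" "H \<subseteq> {1, 2, 3}"
  obtains T where "T \<subseteq> free_columns n" "walsh_coeff n (head n u v H) T \<noteq> 0" "S = H \<union> T"
proof -
  have "\<exists>T. T \<subseteq> free_columns n \<and> walsh_coeff n (head n u v H) T \<noteq> 0 \<and> S = H \<union> T"
    using assms(1) unfolding head_words_image[OF assms(2)] image_iff by blast
  then show ?thesis
    using that by blast
qed

lemma inj_on_head:
  assumes "H \<subseteq> {1, 2, 3}" "A \<subseteq> Pow (free_columns n)"
  shows "inj_on ((\<union>) H) A"
proof (rule inj_on_inverseI)
  fix T assume "T \<in> A"
  then have "T \<subseteq> free_columns n" "H \<inter> free_columns n = {}"
    using assms heads_free_disjoint[of n] by auto
  then show "(H \<union> T) \<inter> free_columns n = T"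
    by auto
qed

lemma card_head_Un:
  assumes "H \<subseteq> {1, 2, 3}" "T \<subseteq> free_columns n"
  shows "card (H \<union> T) = card H + card T"
proof (rule card_Un_disjoint)
  show "finite H" "finite T"
    using assms by (auto intro: finite_subset simp: free_columns_def)
  show "H \<inter> T = {}"
    using assms heads_free_disjoint[of n] by blast
qed

text \<open>The empty product belongs to the trivial character, whose only nonzero coefficient is at
  \<open>T = {}\<close>: the free columns form a full factorial design.\<close>

lemma head_words_empty: "head_words n u v {} = {}"
proof -
  have "T = {}" if "T \<subseteq> free_columns n" "walsh_coeff n (head n u v {}) T \<noteq> 0" for T
  proof -
    have "four_coeff n (\<lambda>j. 0) T \<noteq> 0"
      using that(2) unfolding head_eq walsh_coeff_Re by auto
    from card_of_four_coeff_nonzero[OF that(1) this] have "card T = 0"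
      by simp
    then show ?thesis
      using that(1) by (auto simp: free_columns_def dest: finite_subset)
  qed
  then show ?thesis
    by (auto simp: head_words_image)
qed

lemma finite_D1_words: "finite (D1_words n u v)"
  by (rule finite_subset[of _ "Pow (D1_columns n)"]) (auto simp: D1_words_def D1_columns_def)

text \<open>The empty leading set yields no words; the other seven are grouped in the order of the
  classes (a), (b), (c), (d).\<close>

lemma D1_words_eq_heads:
  "D1_words n u v = (head_words n u v {1} \<union> head_words n u v {1, 2, 3}) \<union>
    (head_words n u v {2} \<union> head_words n u v {3}) \<union> head_words n u v {2, 3} \<union>
    (head_words n u v {1, 2} \<union> head_words n u v {1, 3})"
proof (intro equalityI subsetI)
  fix S assume S: "S \<in> D1_words n u v"
  have "S \<inter> {1, 2, 3} \<noteq> {}"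
    using S head_words_empty[of n u v] unfolding head_words_def by blast
  then have "S \<inter> {1, 2, 3} \<in> {{1}, {1, 2, 3}, {2}, {3}, {2, 3}, {1, 2}, {1, 3}}"
    by (cases "1 \<in> S"; cases "2 \<in> S"; cases "3 \<in> S"; simp)
  then show "S \<in> (head_words n u v {1} \<union> head_words n u v {1, 2, 3}) \<union>
    (head_words n u v {2} \<union> head_words n u v {3}) \<union> head_words n u v {2, 3} \<union>
    (head_words n u v {1, 2} \<union> head_words n u v {1, 3})"
    using S unfolding head_words_def by blast
qed (auto simp: head_words_def)

lemma head_words_disjoint: "H \<noteq> H' \<Longrightarrow> head_words n u v H \<inter> head_words n u v H' = {}"
  by (auto simp: head_words_def)

lemma finite_head_words: "finite (head_words n u v H)"
  by (rule finite_subset[OF _ finite_D1_words]) (auto simp: head_words_def)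

lemma card_head_words_Un:
  "H \<noteq> H' \<Longrightarrow> card (head_words n u v H \<union> head_words n u v H') =
    card (head_words n u v H) + card (head_words n u v H')"
  by (intro card_Un_disjoint finite_head_words head_words_disjoint)

text \<open>A product of columns has entries \<open>\<plusminus>1\<close>, so its mean square in the
  Parseval identity is 1.\<close>

lemma head_words_card_index:
  fixes r :: real
  assumes "H \<subseteq> {1, 2, 3}" "H \<noteq> {}"
    and "\<And>T. T \<subseteq> free_columns n \<Longrightarrow> \<bar>walsh_coeff n (head n u v H) T\<bar> \<in> {0, r}"
  shows "card (head_words n u v H) * r\<^sup>2 = 1"
    and "S \<in> head_words n u v H \<Longrightarrow> aliasing_index n u v S = r"
proof -
  let ?F = "{T. T \<subseteq> free_columns n \<and> walsh_coeff n (head n u v H) T \<noteq> 0}"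
  have image: "head_words n u v H = (\<union>) H ` ?F"
    using assms(2) by (simp add: head_words_image[OF assms(1)])
  then have "card (head_words n u v H) = card ?F"
    using assms(1) by (auto intro!: card_image inj_on_head)
  then show "card (head_words n u v H) * r\<^sup>2 = 1"
    using card_walsh_coeff_nonzero[of n "head n u v H" r] assms(3)
    by (simp add: head_square card_Z4_vecs)
  show "aliasing_index n u v S = r" if "S \<in> head_words n u v H"
  proof -
    obtain T where "T \<subseteq> free_columns n" "walsh_coeff n (head n u v H) T \<noteq> 0" "S = H \<union> T"
      by (rule head_wordsE[OF \<open>S \<in> head_words n u v H\<close> assms(1)])
    then show ?thesis
      using assms(3)[of T] by (simp add: aliasing_index_Un[OF assms(1)])
  qed
qed

text \<open>Serves the leading sets whose product involves one character only. A word then needs a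
  nonzero coefficient of that character, which fixes its length.\<close>

lemma head_words_single_char:
  fixes r :: real
  assumes H: "H \<subseteq> {1, 2, 3}" "H \<noteq> {}"
    and head: "\<And>a. head n u v H a = Re (x * Z4_char n w a)"
    and m: "card {j \<in> {1..n}. odd (w j)} = m" and t: "card {j \<in> {1..n}. w j mod 4 = 2} = t"
    and r: "\<And>z. octagonal m z \<Longrightarrow> \<bar>Re (x * z)\<bar> \<in> {0, r}"
  shows "card (head_words n u v H) * r\<^sup>2 = 1"
    and "S \<in> head_words n u v H \<Longrightarrow> aliasing_index n u v S = r"
    and "S \<in> head_words n u v H \<Longrightarrow>
      card S = m + 2 * t + card H"
proof -
  have walsh: "walsh_coeff n (head n u v H) T = Re (x * four_coeff n w T)" for T
    unfolding head walsh_coeff_Re ..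
  have "\<bar>walsh_coeff n (head n u v H) T\<bar> \<in> {0, r}" if "T \<subseteq> free_columns n" for T
    using r[OF octagonal_four_coeff[OF that, of w, unfolded m]] by (cases "four_coeff n w T = 0") (auto simp: walsh)
  from head_words_card_index[OF H this]
  show "card (head_words n u v H) * r\<^sup>2 = 1"
    and "S \<in> head_words n u v H \<Longrightarrow> aliasing_index n u v S = r" by auto
  assume "S \<in> head_words n u v H"
  then obtain T where T: "T \<subseteq> free_columns n" "S = H \<union> T" "Re (x * four_coeff n w T) \<noteq> 0"
    unfolding walsh[symmetric] by (elim head_wordsE[OF _ H(1)])
  then have "four_coeff n w T \<noteq> 0"
    by auto
  with T show "card S = m + 2 * t + card H"
    using card_of_four_coeff_nonzero[OF T(1)] by (simp add: card_head_Un[OF H(1)] flip: m t)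
qed

text \<open>The positions are partitioned by the sixteen pairs \<open>(u j, v j)\<close>, and
  \<open>P\<close> selects some of the blocks.\<close>

lemma card_freq:
  assumes "u \<in> Z4_vecs n" "v \<in> Z4_vecs n"
  shows "card {j \<in> {1..n}. P (u j) (v j)} =
    (\<Sum>k\<in>{0..3}. \<Sum>s\<in>{0..3}. if P k s then freq n u v k s else 0)"
proof -
  have uv: "u j \<in> {0..3}" "v j \<in> {0..3}" if "j \<in> {1..n}" for j
    using that by (rule PiE_mem[OF assms(1)[unfolded Z4_vecs_def]], rule PiE_mem[OF assms(2)[unfolded Z4_vecs_def]])
  have "of_bool (P (u j) (v j)) = (\<Sum>k\<in>{0..3}. \<Sum>s\<in>{0..3}. if P k s then of_bool (u j = k \<and> v j = s) else 0 :: nat)"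
    if "j \<in> {1..n}" for j
  proof -
    have "(\<Sum>k\<in>{0..3}. \<Sum>s\<in>{0..3}. if P k s then of_bool (u j = k \<and> v j = s) else 0 :: nat) =
      (\<Sum>k\<in>{0..3}. \<Sum>s\<in>{0..3}. if s = v j then if k = u j then of_bool (P (u j) (v j)) else 0 else 0)"
      by (intro sum.cong refl) auto
    also have "\<dots> = of_bool (P (u j) (v j))"
      unfolding sum.delta[OF finite_atLeastAtMost] if_P[OF uv(1)[OF that]] if_P[OF uv(2)[OF that]] ..
    finally show ?thesis ..
  qed
  note of_bool_eq = this
  have "card {j \<in> {1..n}. P (u j) (v j)} = (\<Sum>j\<in>{1..n}. of_bool (P (u j) (v j)))"
    by (simp add: Int_def)
  also have "\<dots> = (\<Sum>j\<in>{1..n}. \<Sum>k\<in>{0..3}. \<Sum>s\<in>{0..3}.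
      if P k s then of_bool (u j = k \<and> v j = s) else 0)"
    by (intro sum.cong refl of_bool_eq)
  also have "\<dots> = (\<Sum>k\<in>{0..3}. \<Sum>s\<in>{0..3}. \<Sum>j\<in>{1..n}.
      if P k s then of_bool (u j = k \<and> v j = s) else 0)"
    by (subst sum.swap, rule sum.cong[OF refl], rule sum.swap)
  also have "\<dots> = (\<Sum>k\<in>{0..3}. \<Sum>s\<in>{0..3}. if P k s then freq n u v k s else 0)"
    by (intro sum.cong refl) (simp add: freq_def Int_def)
  finally show ?thesis .
qed

subsection \<open>Words through both leading coordinates\<close>

text \<open>Opposite exponents give conjugate characters, while the Gray components are
  real.\<close>

lemma local_coeff_minus:
  assumes "(k + l) mod 4 = 0"
  shows "local_coeff b b' l = cnj (local_coeff b b' k)"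
proof -
  have "even k = even l" "k mod 4 = 2 \<longleftrightarrow> l mod 4 = 2" "odd k \<Longrightarrow> k mod 4 = 1 \<longleftrightarrow> l mod 4 \<noteq> 1"
    using assms by presburger+
  then show ?thesis
    by (simp add: local_coeff_eq)
qed

text \<open>Where both entries are odd, \<open>u + v\<close> and \<open>u - v\<close> are 0 and 2
  mod 4 in some order. One character requires that \<open>T\<close> contain neither column of this
  position, the other that it contain both.\<close>

lemma four_coeff_odd_odd:
  assumes "T \<subseteq> free_columns n" "j \<in> {1..n}" "odd (u j)" "odd (v j)"
  shows "four_coeff n (\<lambda>j. 1 * u j + 1 * v j) T = 0 \<or> four_coeff n (\<lambda>j. 1 * u j + 3 * v j) T = 0"
proof -
  have "(1 * u j + 1 * v j) mod 4 = 0 \<and> (1 * u j + 3 * v j) mod 4 = 2 \<or>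
    (1 * u j + 1 * v j) mod 4 = 2 \<and> (1 * u j + 3 * v j) mod 4 = 0"
    using assms(3,4) by presburger
  then have "local_coeff b b' (1 * u j + 1 * v j) = 0 \<or> local_coeff b b' (1 * u j + 3 * v j) = 0" for b b'
    unfolding local_coeff_mod4[of _ _ "1 * u j + 1 * v j"] local_coeff_mod4[of _ _ "1 * u j + 3 * v j"]
    by (elim disjE conjE) (simp_all only: local_coeff_0_3, auto)
  then show ?thesis
    unfolding four_coeff_eq_prod[OF assms(1)]
    using assms(2) by (metis (mono_tags, lifting) finite_atLeastAtMost prod_zero)
qed

text \<open>The positions are split by the parity of \<open>v j\<close>. If it is even,
  \<open>u + v\<close> and \<open>u - v\<close> agree mod 4 and have the same factor, collected in
  \<open>P\<close>. If it is odd, \<open>u j\<close> is even, so they are opposite mod 4 and have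
  conjugate factors, collected in \<open>Q\<close>.\<close>

lemma four_coeff_split:
  assumes "T \<subseteq> free_columns n" "\<And>j. j \<in> {1..n} \<Longrightarrow> even (u j) \<or> even (v j)"
  obtains P Q where "four_coeff n (\<lambda>j. 1 * u j + 1 * v j) T = P * Q"
    and "four_coeff n (\<lambda>j. 1 * u j + 3 * v j) T = P * cnj Q"
    and "P * Q \<noteq> 0 \<Longrightarrow> octagonal (card {j \<in> {1..n}. odd (u j)}) P"
    and "P * Q \<noteq> 0 \<Longrightarrow> octagonal (card {j \<in> {1..n}. odd (v j)}) Q"
proof
  let ?c = "\<lambda>w j. local_coeff (2 * j + 2 \<in> T) (2 * j + 3 \<in> T) (w j)"
  let ?p = "\<lambda>j. 1 * u j + 1 * v j" and ?m = "\<lambda>j. 1 * u j + 3 * v j"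
  let ?E = "{j \<in> {1..n}. even (v j)}" and ?O = "{j \<in> {1..n}. odd (v j)}"
  have split: "(\<Prod>j\<in>{1..n}. f j) = prod f ?E * prod f ?O" for f :: "nat \<Rightarrow> complex"
    by (subst prod.union_disjoint[symmetric]) (auto intro: prod.cong)
  show prod: "four_coeff n ?p T = prod (?c ?p) ?E * prod (?c ?p) ?O"
    unfolding four_coeff_eq_prod[OF assms(1)] split ..
  have "?c ?m j = ?c ?p j" if "j \<in> ?E" for j
  proof -
    have "even (v j)"
      using that by simp
    then have "?m j mod 4 = ?p j mod 4"
      by presburger
    then show ?thesis
      using local_coeff_mod4 by metis
  qed
  moreover have "?c ?m j = cnj (?c ?p j)" if "j \<in> ?O" for j
  proof (rule local_coeff_minus)
    have "even (u j)"
      using that assms(2)[of j] by auto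
    then show "(?p j + ?m j) mod 4 = 0"
      by presburger
  qed
  ultimately show "four_coeff n ?m T = prod (?c ?p) ?E * cnj (prod (?c ?p) ?O)"
    unfolding four_coeff_eq_prod[OF assms(1)] split by simp
  assume "prod (?c ?p) ?E * prod (?c ?p) ?O \<noteq> 0"
  then have "?c ?p j \<noteq> 0" if "j \<in> {1..n}" for j
    using that by auto
  then have "octagonal (card {j \<in> ?E. odd (?p j)}) (prod (?c ?p) ?E)"
    "octagonal (card {j \<in> ?O. odd (?p j)}) (prod (?c ?p) ?O)"
    by (intro octagonal_prod_local_coeff; simp)+
  moreover have "{j \<in> ?E. odd (?p j)} = {j \<in> {1..n}. odd (u j)}" "{j \<in> ?O. odd (?p j)} = {j \<in> {1..n}. odd (v j)}"
    using assms(2) by auto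
  ultimately show "octagonal (card {j \<in> {1..n}. odd (u j)}) (prod (?c ?p) ?E)"
    "octagonal (card {j \<in> {1..n}. odd (v j)}) (prod (?c ?p) ?O)"
    by simp_all
qed

lemma walsh_coeff_mixed_heads:
  "walsh_coeff n (head n u v {1, 2}) T =
    Re (1 * four_coeff n (\<lambda>j. 1 * u j + 1 * v j) T) + Re (\<i> * four_coeff n (\<lambda>j. 1 * u j + 3 * v j) T)"
  "walsh_coeff n (head n u v {1, 3}) T =
    Re (\<i> * four_coeff n (\<lambda>j. 1 * u j + 1 * v j) T) + Re (1 * four_coeff n (\<lambda>j. 1 * u j + 3 * v j) T)"
  unfolding head_eq walsh_coeff_add walsh_coeff_Re by (rule refl)+

text \<open>Here \<open>u + v\<close> and \<open>u - v\<close> have nonzero coefficients at the same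
  sets \<open>T\<close>, so all words have one length, read off from \<open>u + v\<close>.\<close>

lemma mixed_head_words_even:
  fixes n u v and r :: real
  defines "W \<equiv> head_words n u v {1, 2} \<union> head_words n u v {1, 3}"
    and "r \<equiv> 1 / 2 ^ (card {j \<in> {1..n}. odd (u j)} div 2) * (1 / 2 ^ (card {j \<in> {1..n}. odd (v j)} div 2))"
  assumes ev: "\<And>j. j \<in> {1..n} \<Longrightarrow> even (u j) \<or> even (v j)"
  shows "card W * r\<^sup>2 = 2"
    and "S \<in> W \<Longrightarrow> aliasing_index n u v S = r"
    and "S \<in> W \<Longrightarrow> card S = card {j \<in> {1..n}. odd (u j + v j)} + 2 * card {j \<in> {1..n}. (u j + v j) mod 4 = 2} + 2"
proof -
  have walsh: "\<bar>walsh_coeff n (head n u v {1, 2}) T\<bar> \<in> {0, r} \<and> \<bar>walsh_coeff n (head n u v {1, 3}) T\<bar> \<in> {0, r} \<and>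
      (four_coeff n (\<lambda>j. 1 * u j + 1 * v j) T = 0 \<longrightarrow>
        walsh_coeff n (head n u v {1, 2}) T = 0 \<and> walsh_coeff n (head n u v {1, 3}) T = 0)"
    if T: "T \<subseteq> free_columns n" for T
  proof -
    obtain P Q where PQ: "four_coeff n (\<lambda>j. 1 * u j + 1 * v j) T = P * Q"
      "four_coeff n (\<lambda>j. 1 * u j + 3 * v j) T = P * cnj Q"
      "P * Q \<noteq> 0 \<Longrightarrow> octagonal (card {j \<in> {1..n}. odd (u j)}) P"
      "P * Q \<noteq> 0 \<Longrightarrow> octagonal (card {j \<in> {1..n}. odd (v j)}) Q"
      by (rule four_coeff_split[where u = u and v = v, OF T ev]) auto
    \<comment> \<open>The two contributions combine into a product of real parts, one governed by
      the odd entries of \<open>u\<close> and the other by those of \<open>v\<close>; this is why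
      the index is a product.\<close>
    have eq: "walsh_coeff n (head n u v {1, 2}) T = Re ((1 + \<i>) * P) * Re ((1 - \<i>) * Q)"
      "walsh_coeff n (head n u v {1, 3}) T = Re ((1 + \<i>) * P) * Re ((1 + \<i>) * Q)"
      unfolding walsh_coeff_mixed_heads PQ(1,2) by (simp_all add: algebra_simps)
    show ?thesis
    proof (cases "P * Q = 0")
      case True
      then show ?thesis
        unfolding eq by auto
    next
      case False
      have "\<bar>Re ((1 + \<i>) * P)\<bar> \<in> {0, 1 / 2 ^ (card {j \<in> {1..n}. odd (u j)} div 2)}"
        by (rule octagonal_Re_unit[OF PQ(3)[OF False]]) simp
      moreover have "\<bar>Re ((1 - \<i>) * Q)\<bar> \<in> {0, 1 / 2 ^ (card {j \<in> {1..n}. odd (v j)} div 2)}"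
        "\<bar>Re ((1 + \<i>) * Q)\<bar> \<in> {0, 1 / 2 ^ (card {j \<in> {1..n}. odd (v j)} div 2)}"
        by (rule octagonal_Re_unit[OF PQ(4)[OF False]], simp)+
      moreover have "\<bar>p * q\<bar> \<in> {0, r}" if "\<bar>p\<bar> \<in> {0, 1 / 2 ^ (card {j \<in> {1..n}. odd (u j)} div 2)}"
        "\<bar>q\<bar> \<in> {0, 1 / 2 ^ (card {j \<in> {1..n}. odd (v j)} div 2)}" for p q :: real
        using that unfolding r_def abs_mult by auto
      ultimately show ?thesis
        using False unfolding eq PQ(1) by blast
    qed
  qed
  have H: "{1, 2} \<subseteq> {1, 2, 3 :: nat}" "{1, 2} \<noteq> ({} :: nat set)" "{1, 3} \<subseteq> {1, 2, 3 :: nat}" "{1, 3} \<noteq> ({} :: nat set)"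
    by auto
  note 12 = head_words_card_index[OF H(1,2), of n u v r]
  note 13 = head_words_card_index[OF H(3,4), of n u v r]
  have "card W = card (head_words n u v {1, 2}) + card (head_words n u v {1, 3})"
    unfolding W_def
    by (rule card_head_words_Un) (simp add: doubleton_eq_iff)
  then show "card W * r\<^sup>2 = 2"
    using 12(1) 13(1) walsh by (simp add: distrib_right)
  show "aliasing_index n u v S = r" if "S \<in> W"
    using that 12(2) 13(2) walsh unfolding W_def by blast
  assume "S \<in> W"
  then obtain H where H': "S \<in> head_words n u v H" "H = {1, 2} \<or> H = {1, 3}"
    unfolding W_def by blast
  then have H3: "H \<subseteq> {1, 2, 3}"
    by auto
  obtain T where T: "T \<subseteq> free_columns n" "walsh_coeff n (head n u v H) T \<noteq> 0" "S = H \<union> T"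
    by (rule head_wordsE[OF H'(1) H3])
  have "four_coeff n (\<lambda>j. 1 * u j + 1 * v j) T \<noteq> 0"
    using walsh[OF T(1)] H'(2) T(2) by auto
  from card_of_four_coeff_nonzero[OF T(1) this]
  show "card S = card {j \<in> {1..n}. odd (u j + v j)} + 2 * card {j \<in> {1..n}. (u j + v j) mod 4 = 2} + 2"
    using H'(2) T(3) card_head_Un[OF H3 T(1)] by auto
qed

text \<open>One position with both entries odd already prevents \<open>u + v\<close> and
  \<open>u - v\<close> from contributing to the same set. The words thus fall into two kinds, with
  lengths given by the one or the other character.\<close>

lemma mixed_head_words_odd:
  fixes n u v and r :: real
  defines "W \<equiv> head_words n u v {1, 2} \<union> head_words n u v {1, 3}"
    and "r \<equiv> 1 / 2 ^ ((card {j \<in> {1..n}. odd (u j + v j)} + 1) div 2)"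
  assumes j: "j \<in> {1..n}" "odd (u j)" "odd (v j)"
  shows "card W * r\<^sup>2 = 2"
    and "S \<in> W \<Longrightarrow> aliasing_index n u v S = r"
    and "half_lengths W
      (card {j \<in> {1..n}. odd (u j + v j)} + 2 * card {j \<in> {1..n}. (u j + v j) mod 4 = 2} + 2)
      (card {j \<in> {1..n}. odd (u j + v j)} + 2 * card {j \<in> {1..n}. (u j + 3 * v j) mod 4 = 2} + 2)"
proof -
  let ?A = "four_coeff n (\<lambda>j. 1 * u j + 1 * v j)" and ?B = "four_coeff n (\<lambda>j. 1 * u j + 3 * v j)"
  let ?m = "card {j \<in> {1..n}. odd (u j + v j)}"
  have zero: "?A T = 0 \<or> ?B T = 0" if "T \<subseteq> free_columns n" for T
    by (rule four_coeff_odd_odd[where u = u and v = v, OF that j])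
  have AB: "\<bar>Re (x * ?A T)\<bar> \<in> {0, r} \<and> \<bar>Re (x * ?B T)\<bar> \<in> {0, r}"
    if T: "T \<subseteq> free_columns n" and x: "x = 1 \<or> x = \<i>" for T x
  proof -
    have oct: "octagonal ?m (?A T)" if "?A T \<noteq> 0"
      using octagonal_four_coeff[OF T that] by simp
    have oct': "octagonal ?m (?B T)" if "?B T \<noteq> 0"
      using octagonal_four_coeff[OF T that] by simp
    have "\<bar>Re (x * z)\<bar> \<in> {0, r}" if "z \<noteq> 0 \<Longrightarrow> octagonal ?m z" for z
      using that octagonal_Re[of ?m z] octagonal_Im[of ?m z] x unfolding r_def
      by (cases "z = 0") auto
    then show ?thesis
      using oct oct' by blast
  qed
  have H: "{1, 2} \<subseteq> {1, 2, 3 :: nat}" "{1, 2} \<noteq> ({} :: nat set)" "{1, 3} \<subseteq> {1, 2, 3 :: nat}" "{1, 3} \<noteq> ({} :: nat set)"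
    by auto
  \<comment> \<open>At most one of the two summands is nonzero, so no cancellation or addition
    changes the modulus.\<close>
  have w12: "\<bar>walsh_coeff n (head n u v {1, 2}) T\<bar> \<in> {0, r}"
    and w13: "\<bar>walsh_coeff n (head n u v {1, 3}) T\<bar> \<in> {0, r}" if T: "T \<subseteq> free_columns n" for T
    using AB[OF T, of 1] AB[OF T, of \<i>] zero[OF T] unfolding walsh_coeff_mixed_heads by auto
  note 12 = head_words_card_index[OF H(1,2) w12, simplified]
  note 13 = head_words_card_index[OF H(3,4) w13, simplified]
  have "card W = card (head_words n u v {1, 2}) + card (head_words n u v {1, 3})"
    unfolding W_def
    by (rule card_head_words_Un) (simp add: doubleton_eq_iff)
  then show cardW: "card W * r\<^sup>2 = 2"
    using 12(1) 13(1) by (simp add: distrib_right)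
  show "aliasing_index n u v S = r" if "S \<in> W"
    using that 12(2) 13(2) unfolding W_def by auto

  text \<open>Exactly one of the characters \<open>u + v\<close> and \<open>u - v\<close> contributes to a given word; \<open>Y\<close> collects the
    words of the first. They are counted by Parseval for the real and imaginary parts of that character.\<close>
  define F where "F x = {T. T \<subseteq> free_columns n \<and> walsh_coeff n (\<lambda>a. Re (x * Z4_char n (\<lambda>j. 1 * u j + 1 * v j) a)) T \<noteq> 0}" for x
  define Y where "Y = (\<union>) {1, 2} ` F 1 \<union> (\<union>) {1, 3} ` F \<i>"
  have F: "T \<subseteq> free_columns n" "?A T \<noteq> 0" "?B T = 0" "Re (x * ?A T) \<noteq> 0" if "T \<in> F x" for T x
    using that zero[of T] unfolding F_def walsh_coeff_Re by auto
  have Y12: "(\<union>) {1, 2} ` F 1 \<subseteq> head_words n u v {1, 2}"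
    unfolding head_words_image[OF H(1)] walsh_coeff_mixed_heads
    using F by (intro image_mono) force
  have Y13: "(\<union>) {1, 3} ` F \<i> \<subseteq> head_words n u v {1, 3}"
    unfolding head_words_image[OF H(3)] walsh_coeff_mixed_heads
    using F by (intro image_mono) force
  have YW: "Y \<subseteq> W"
    unfolding Y_def W_def using Y12 Y13 by blast
  have "card (F x) * r\<^sup>2 = (\<Sum>a\<in>Z4_vecs n. (Re (x * Z4_char n (\<lambda>j. 1 * u j + 1 * v j) a))\<^sup>2) / 4 ^ n"
    if "x = 1 \<or> x = \<i>" for x
    unfolding F_def using AB that by (intro card_walsh_coeff_nonzero) (simp only: walsh_coeff_Re)
  then have "card (F 1) * r\<^sup>2 + card (F \<i>) * r\<^sup>2 =
      (\<Sum>a\<in>Z4_vecs n. (Re (1 * Z4_char n (\<lambda>j. 1 * u j + 1 * v j) a))\<^sup>2 +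
        (Re (\<i> * Z4_char n (\<lambda>j. 1 * u j + 1 * v j) a))\<^sup>2) / 4 ^ n"
    by (simp only: sum.distrib add_divide_distrib) simp
  \<comment> \<open>How the count is shared between \<open>F 1\<close> and \<open>F \<i>\<close>
    depends on the character, but the squares of its real and imaginary parts always add up to 1.
    Hence \<open>Y\<close> accounts for half of \<open>W\<close>.\<close>
  also have "\<dots> = (\<Sum>a\<in>Z4_vecs n. 1) / 4 ^ n"
  proof -
    have "(Re (1 * Z4_char n w a))\<^sup>2 + (Re (\<i> * Z4_char n w a))\<^sup>2 = 1" for w a
      using Z4_char_cases[of n w a] by auto
    then show ?thesis
      by simp
  qed
  finally have F1: "card (F 1) * r\<^sup>2 + card (F \<i>) * r\<^sup>2 = 1"
    by (simp add: card_Z4_vecs)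
  have sub: "F x \<subseteq> Pow (free_columns n)" for x
    by (auto simp: F_def)
  then have fin: "finite (F x)" for x
    by (rule finite_subset) (simp add: free_columns_def)
  have "card ((\<union>) {1, 2} ` F 1) = card (F 1)" "card ((\<union>) {1, 3} ` F \<i>) = card (F \<i>)"
    by (rule card_image, rule inj_on_head[OF H(1) sub], rule card_image, rule inj_on_head[OF H(3) sub])
  moreover have "(\<union>) {1, 2} ` F 1 \<inter> (\<union>) {1, 3} ` F \<i> = {}"
  proof -
    have "head_words n u v {1, 2} \<inter> head_words n u v {1, 3} = {}"
      by (rule head_words_disjoint) (simp add: doubleton_eq_iff)
    then show ?thesis
      using Y12 Y13 by blast
  qed
  ultimately have "card Y = card (F 1) + card (F \<i>)"
    unfolding Y_def using fin by (simp add: card_Un_disjoint)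
  then have "(2 * card Y) * r\<^sup>2 = card W * r\<^sup>2"
    using F1 cardW by (simp add: algebra_simps)
  then have half: "2 * card Y = card W"
    by (simp add: r_def)
  have "card S = ?m + 2 * card {j \<in> {1..n}. (u j + v j) mod 4 = 2} + 2" if "S \<in> Y" for S
  proof -
    have "(\<exists>T\<in>F 1. S = {1, 2} \<union> T) \<or> (\<exists>T\<in>F \<i>. S = {1, 3} \<union> T)"
      using that unfolding Y_def Un_iff image_iff .
    then obtain H' T x where HT: "S = H' \<union> T" "T \<in> F x" "H' = {1, 2} \<or> H' = {1, 3}"
      by metis
    then have H3: "H' \<subseteq> {1, 2, 3}"
      by auto
    from card_of_four_coeff_nonzero[OF F(1,2)[OF HT(2)]]
    show ?thesis
      using HT(1,3) card_head_Un[OF H3 F(1)[OF HT(2)]] by auto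
  qed
  moreover have "card S = ?m + 2 * card {j \<in> {1..n}. (u j + 3 * v j) mod 4 = 2} + 2" if SW: "S \<in> W - Y" for S
  proof -
    obtain H' where H': "S \<in> head_words n u v H'" "H' = {1, 2} \<or> H' = {1, 3}"
      using SW unfolding W_def by blast
    then have H3: "H' \<subseteq> {1, 2, 3}"
      by auto
    obtain T where T: "T \<subseteq> free_columns n" "walsh_coeff n (head n u v H') T \<noteq> 0" "S = H' \<union> T"
      by (rule head_wordsE[OF H'(1) H3])
    \<comment> \<open>If the coefficient of \<open>u - v\<close> vanished, the word would come from
      \<open>u + v\<close> and lie in \<open>Y\<close>.\<close>
    have "?B T \<noteq> 0"
    proof
      assume "?B T = 0"
      from H'(2) have "H' \<union> T \<in> Y"
      proof
        assume H'_eq: "H' = {1, 2}"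
        then have "T \<in> F 1"
          using T(1,2) \<open>?B T = 0\<close> unfolding F_def walsh_coeff_Re by (simp add: walsh_coeff_mixed_heads[simplified])
        then show ?thesis
          unfolding Y_def H'_eq by (intro UnI1 imageI)
      next
        assume H'_eq: "H' = {1, 3}"
        then have "T \<in> F \<i>"
          using T(1,2) \<open>?B T = 0\<close> unfolding F_def walsh_coeff_Re by (simp add: walsh_coeff_mixed_heads[simplified])
        then show ?thesis
          unfolding Y_def H'_eq by (intro UnI2 imageI)
      qed
      then show False
        using SW T(3) by simp
    qed
    from card_of_four_coeff_nonzero[OF T(1) this]
    show ?thesis
      using H'(2) T(3) card_head_Un[OF H3 T(1)] by auto
  qed
  ultimately show "half_lengths W
      (?m + 2 * card {j \<in> {1..n}. (u j + v j) mod 4 = 2} + 2)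
      (?m + 2 * card {j \<in> {1..n}. (u j + 3 * v j) mod 4 = 2} + 2)"
    using YW half unfolding half_lengths_def by blast
qed

subsection \<open>Class sizes and lengths\<close>

text \<open>The case of the leading sets \<open>{1}\<close>, \<open>{2}\<close>, \<open>{3}\<close>
  and \<open>{1, 2, 3}\<close>, where the character is scaled by
  \<open>1 \<plusminus> \<i>\<close>.\<close>

lemma head_words_unit_char:
  assumes H: "H \<subseteq> {1, 2, 3}" "H \<noteq> {}"
    and x: "x = 1 + \<i> \<or> x = 1 - \<i>"
    and head: "\<And>a. head n u v H a = Re (x * Z4_char n w a)"
    and m: "card {j \<in> {1..n}. odd (w j)} = m" and t: "card {j \<in> {1..n}. w j mod 4 = 2} = t"
  shows "card (head_words n u v H) * (1 / 2 ^ (m div 2))\<^sup>2 = (1 :: real)"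
    and "S \<in> head_words n u v H \<Longrightarrow> aliasing_index n u v S = 1 / 2 ^ (m div 2)"
    and "S \<in> head_words n u v H \<Longrightarrow> card S = m + 2 * t + card H"
  using head_words_single_char[OF H head m t octagonal_Re_unit[OF _ x]] by blast+

lemma half_lengths_Un:
  assumes "finite A" "finite B" "A \<inter> B = {}" "card A = card B"
    and "\<And>S. S \<in> A \<Longrightarrow> card S = p" "\<And>S. S \<in> B \<Longrightarrow> card S = q"
  shows "half_lengths (A \<union> B) p q"
  unfolding half_lengths_def using assms by (intro exI[of _ A]) (auto simp: card_Un_disjoint)

text \<open>These are the numbers of odd entries and of entries 2 mod 4 of the characters that
  occur, written as in \<open>head_eq\<close> or simplified; the fourth count decides between (d1)
  and (d2).\<close>

lemma card_freq_eqs: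
  assumes "u \<in> Z4_vecs n" "v \<in> Z4_vecs n"
  shows "card {j \<in> {1..n}. odd (u j)} = lam1 n u v + lam3 n u v + lam5 n u v + lam6 n u v"
    and "card {j \<in> {1..n}. odd (v j)} = lam2 n u v + lam4 n u v + lam5 n u v + lam6 n u v"
    and "card {j \<in> {1..n}. odd (u j + v j)} = lam1 n u v + lam2 n u v + lam3 n u v + lam4 n u v"
    and "card {j \<in> {1..n}. odd (u j) \<and> odd (v j)} = lam5 n u v + lam6 n u v"
    and "card {j \<in> {1..n}. u j mod 4 = 2} = lam4 n u v + lam8 n u v + lam9 n u v"
    and "card {j \<in> {1..n}. v j mod 4 = 2} = lam3 n u v + lam7 n u v + lam9 n u v"
    and "card {j \<in> {1..n}. (0 * u j + 2 * v j) mod 4 = 2} = lam2 n u v + lam4 n u v + lam5 n u v + lam6 n u v"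
    and "card {j \<in> {1..n}. (1 * u j + 2 * v j) mod 4 = 2} = lam2 n u v + lam8 n u v + lam9 n u v"
    and "card {j \<in> {1..n}. (u j + v j) mod 4 = 2} = lam5 n u v + lam7 n u v + lam8 n u v"
    and "card {j \<in> {1..n}. (u j + 3 * v j) mod 4 = 2} = lam6 n u v + lam7 n u v + lam8 n u v"
    and "card {j \<in> {1..n}. odd (0 * u j + 2 * v j)} = 0"
    and "card {j \<in> {1..n}. odd (1 * u j + 2 * v j)} = lam1 n u v + lam3 n u v + lam5 n u v + lam6 n u v"
proof -
  note eqs = atLeastAtMost_0_3 lam1_def lam2_def lam3_def lam4_def lam5_def lam6_def lam7_def
    lam8_def lam9_def
  note freq = card_freq[OF assms]
  show "card {j \<in> {1..n}. odd (u j)} = lam1 n u v + lam3 n u v + lam5 n u v + lam6 n u v"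
    unfolding freq[of "\<lambda>k s. odd k"] by (simp add: eqs)
  show "card {j \<in> {1..n}. odd (v j)} = lam2 n u v + lam4 n u v + lam5 n u v + lam6 n u v"
    unfolding freq[of "\<lambda>k s. odd s"] by (simp add: eqs)
  show "card {j \<in> {1..n}. odd (u j + v j)} = lam1 n u v + lam2 n u v + lam3 n u v + lam4 n u v"
    unfolding freq[of "\<lambda>k s. odd (k + s)"] by (simp add: eqs)
  show "card {j \<in> {1..n}. odd (u j) \<and> odd (v j)} = lam5 n u v + lam6 n u v"
    unfolding freq[of "\<lambda>k s. odd k \<and> odd s"] by (simp add: eqs)
  show "card {j \<in> {1..n}. u j mod 4 = 2} = lam4 n u v + lam8 n u v + lam9 n u v"
    unfolding freq[of "\<lambda>k s. k mod 4 = 2"] by (simp add: eqs)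
  show "card {j \<in> {1..n}. v j mod 4 = 2} = lam3 n u v + lam7 n u v + lam9 n u v"
    unfolding freq[of "\<lambda>k s. s mod 4 = 2"] by (simp add: eqs)
  show "card {j \<in> {1..n}. (0 * u j + 2 * v j) mod 4 = 2} = lam2 n u v + lam4 n u v + lam5 n u v + lam6 n u v"
    unfolding freq[of "\<lambda>k s. (0 * k + 2 * s) mod 4 = 2"] by (simp add: eqs)
  show "card {j \<in> {1..n}. (1 * u j + 2 * v j) mod 4 = 2} = lam2 n u v + lam8 n u v + lam9 n u v"
    unfolding freq[of "\<lambda>k s. (1 * k + 2 * s) mod 4 = 2"] by (simp add: eqs)
  show "card {j \<in> {1..n}. (u j + v j) mod 4 = 2} = lam5 n u v + lam7 n u v + lam8 n u v"
    unfolding freq[of "\<lambda>k s. (k + s) mod 4 = 2"] by (simp add: eqs)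
  show "card {j \<in> {1..n}. (u j + 3 * v j) mod 4 = 2} = lam6 n u v + lam7 n u v + lam8 n u v"
    unfolding freq[of "\<lambda>k s. (k + 3 * s) mod 4 = 2"] by (simp add: eqs)
  show "card {j \<in> {1..n}. odd (0 * u j + 2 * v j)} = 0"
    by simp
  show "card {j \<in> {1..n}. odd (1 * u j + 2 * v j)} = lam1 n u v + lam3 n u v + lam5 n u v + lam6 n u v"
    unfolding freq[of "\<lambda>k s. odd (1 * k + 2 * s)"] by (simp add: eqs)
qed

theorem theorem3:
  fixes n :: nat and u v :: "nat \<Rightarrow> nat"
  assumes "n \<ge> 1" and "u \<in> Z4_vecs n" and "v \<in> Z4_vecs n"
  shows "\<exists>Wa Wb Wc Wd.
    D1_words n u v = Wa \<union> Wb \<union> Wc \<union> Wd \<and>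
    Wa \<inter> Wb = {} \<and> Wa \<inter> Wc = {} \<and> Wa \<inter> Wd = {} \<and>
    Wb \<inter> Wc = {} \<and> Wb \<inter> Wd = {} \<and> Wc \<inter> Wd = {} \<and>
    (real (card Wa) = 2 / (rho1 n u v)\<^sup>2 \<and>
      (\<forall>S\<in>Wa. aliasing_index n u v S = rho1 n u v) \<and>
      half_lengths Wa (ell1 n u v + 1) (ell3 n u v + 3)) \<and>
    (real (card Wb) = 2 / (rho2 n u v)\<^sup>2 \<and>
      (\<forall>S\<in>Wb. aliasing_index n u v S = rho2 n u v \<and> card S = ell2 n u v + 1)) \<and>
    (card Wc = 1 \<and>
      (\<forall>S\<in>Wc. aliasing_index n u v S = 1 \<and> card S = ell6 n u v + 2)) \<and>
    (lam5 n u v + lam6 n u v = 0 \<longrightarrow>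
      real (card Wd) = 2 / ((xi1 n u v)\<^sup>2 * (xi2 n u v)\<^sup>2) \<and>
      (\<forall>S\<in>Wd. aliasing_index n u v S = xi1 n u v * xi2 n u v \<and> card S = ell8 n u v + 2)) \<and>
    (lam5 n u v + lam6 n u v > 0 \<longrightarrow>
      real (card Wd) = 2 / (xi n u v)\<^sup>2 \<and>
      (\<forall>S\<in>Wd. aliasing_index n u v S = xi n u v) \<and>
      half_lengths Wd (ell9 n u v + 2) (ell10 n u v + 2))"
proof -
  note eqs = card_freq_eqs[OF assms(2,3)]
  define W where "W = head_words n u v"
  have fin: "finite (W H)" for H
    unfolding W_def by (rule finite_head_words)
  have disj: "W H \<inter> W H' = {}" if "H \<noteq> H'" for H H'
    unfolding W_def using that by (rule head_words_disjoint)
  have card_Un: "card (W H \<union> W H') = card (W H) + card (W H')" if "H \<noteq> H'" for H H'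
    unfolding W_def using that by (rule card_head_words_Un)
  have neq: "{1} \<noteq> {1, 2, 3 :: nat}" "{2} \<noteq> {3 :: nat}"
    by auto
  have pos: "rho1 n u v \<noteq> 0" "rho2 n u v \<noteq> 0" "xi1 n u v \<noteq> 0" "xi2 n u v \<noteq> 0" "xi n u v \<noteq> 0"
    by (simp_all add: rho1_def rho2_def xi1_def xi2_def xi_def)

  have W1: "card (W {1}) * (rho1 n u v)\<^sup>2 = 1"
    "S \<in> W {1} \<Longrightarrow> aliasing_index n u v S = rho1 n u v"
    "S \<in> W {1} \<Longrightarrow> card S = ell1 n u v + 1" for S
    using head_words_unit_char[where H = "{1}", OF _ _ _ head_eq(2)[where v = v] eqs(1) eqs(5), folded rho1_def W_def]
    by (simp_all add: ell1_def)
  have W123: "card (W {1, 2, 3}) * (rho1 n u v)\<^sup>2 = 1"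
    "S \<in> W {1, 2, 3} \<Longrightarrow> aliasing_index n u v S = rho1 n u v"
    "S \<in> W {1, 2, 3} \<Longrightarrow> card S = ell3 n u v + 3" for S
    using head_words_unit_char[where H = "{1, 2, 3}", OF _ _ _ head_eq(6) eqs(12) eqs(8), folded rho1_def W_def]
    by (simp_all add: ell3_def)
  have W2: "card (W {2}) * (rho2 n u v)\<^sup>2 = 1"
    "S \<in> W {2} \<Longrightarrow> aliasing_index n u v S = rho2 n u v"
    "S \<in> W {2} \<Longrightarrow> card S = ell2 n u v + 1" for S
    using head_words_unit_char[where H = "{2}", OF _ _ _ head_eq(3)[where u = u] eqs(2) eqs(6), folded rho2_def W_def]
    by (simp_all add: ell2_def)
  have W3: "card (W {3}) * (rho2 n u v)\<^sup>2 = 1"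
    "S \<in> W {3} \<Longrightarrow> aliasing_index n u v S = rho2 n u v"
    "S \<in> W {3} \<Longrightarrow> card S = ell2 n u v + 1" for S
    using head_words_unit_char[where H = "{3}", OF _ _ _ head_eq(4)[where u = u] eqs(2) eqs(6), folded rho2_def W_def]
    by (simp_all add: ell2_def)
  \<comment> \<open>The character of \<open>2v\<close> has no odd entries, so its nonzero
    coefficients have modulus 1 and there is exactly one word.\<close>
  have "\<bar>Re (1 * z)\<bar> \<in> {0, 1}" if "octagonal 0 z" for z
    using octagonal_Re[OF that] by simp
  from head_words_single_char[where H = "{2, 3}", OF _ _ head_eq(5) eqs(11) eqs(7) this, folded W_def]
  have W23: "card (W {2, 3}) = 1"
    "S \<in> W {2, 3} \<Longrightarrow> aliasing_index n u v S = 1"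
    "S \<in> W {2, 3} \<Longrightarrow> card S = ell6 n u v + 2" for S
    by (simp_all add: ell6_def)

  have a: "real (card (W {1} \<union> W {1, 2, 3})) = 2 / (rho1 n u v)\<^sup>2"
    "\<forall>S\<in>W {1} \<union> W {1, 2, 3}. aliasing_index n u v S = rho1 n u v"
    "half_lengths (W {1} \<union> W {1, 2, 3}) (ell1 n u v + 1) (ell3 n u v + 3)"
  proof -
    have "card (W {1}) = 1 / (rho1 n u v)\<^sup>2" "card (W {1, 2, 3}) = 1 / (rho1 n u v)\<^sup>2"
      using W1(1) W123(1) pos by (simp_all add: nonzero_eq_divide_eq)
    then show "real (card (W {1} \<union> W {1, 2, 3})) = 2 / (rho1 n u v)\<^sup>2"
      and "half_lengths (W {1} \<union> W {1, 2, 3}) (ell1 n u v + 1) (ell3 n u v + 3)"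
      using card_Un[OF neq(1)] disj[OF neq(1)] W1(3) W123(3) fin
      by (simp, intro half_lengths_Un) simp_all
    show "\<forall>S\<in>W {1} \<union> W {1, 2, 3}. aliasing_index n u v S = rho1 n u v"
      using W1(2) W123(2) by blast
  qed
  have b: "real (card (W {2} \<union> W {3})) = 2 / (rho2 n u v)\<^sup>2"
    "\<forall>S\<in>W {2} \<union> W {3}. aliasing_index n u v S = rho2 n u v \<and> card S = ell2 n u v + 1"
  proof -
    have "card (W {2}) = 1 / (rho2 n u v)\<^sup>2" "card (W {3}) = 1 / (rho2 n u v)\<^sup>2"
      using W2(1) W3(1) pos by (simp_all add: nonzero_eq_divide_eq)
    then show "real (card (W {2} \<union> W {3})) = 2 / (rho2 n u v)\<^sup>2"
      using card_Un[OF neq(2)] by simp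
    show "\<forall>S\<in>W {2} \<union> W {3}. aliasing_index n u v S = rho2 n u v \<and> card S = ell2 n u v + 1"
      using W2(2,3) W3(2,3) by blast
  qed
  have d1: "real (card (W {1, 2} \<union> W {1, 3})) = 2 / ((xi1 n u v)\<^sup>2 * (xi2 n u v)\<^sup>2) \<and>
      (\<forall>S\<in>W {1, 2} \<union> W {1, 3}. aliasing_index n u v S = xi1 n u v * xi2 n u v \<and> card S = ell8 n u v + 2)"
    if zero: "lam5 n u v + lam6 n u v = 0"
  proof -
    have "{j \<in> {1..n}. odd (u j) \<and> odd (v j)} = {}"
      using eqs(4) zero by simp
    then have ev: "even (u j) \<or> even (v j)" if "j \<in> {1..n}" for j
      using that by blast
    note mixed = mixed_head_words_even[where n = n and u = u and v = v, OF ev, folded W_def, unfolded eqs(1-10)]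
    \<comment> \<open>With \<open>lam5\<close> and \<open>lam6\<close> zero, the odd entries of
      \<open>u\<close> and \<open>v\<close> number \<open>lam1 + lam3\<close> and
      \<open>lam2 + lam4\<close>.\<close>
    have xi: "1 / 2 ^ ((lam1 n u v + lam3 n u v + lam5 n u v + lam6 n u v) div 2) *
        (1 / 2 ^ ((lam2 n u v + lam4 n u v + lam5 n u v + lam6 n u v) div 2)) = xi1 n u v * xi2 n u v"
      using zero by (simp add: xi1_def xi2_def)
    have "card (W {1, 2} \<union> W {1, 3}) * ((xi1 n u v)\<^sup>2 * (xi2 n u v)\<^sup>2) = 2"
      using mixed(1) unfolding xi power_mult_distrib by simp
    moreover have "aliasing_index n u v S = xi1 n u v * xi2 n u v" "card S = ell8 n u v + 2"
      if "S \<in> W {1, 2} \<union> W {1, 3}" for S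
      using mixed(2,3)[OF _ that] zero unfolding xi by (simp_all add: ell8_def)
    ultimately show ?thesis
      using pos by (simp add: nonzero_eq_divide_eq)
  qed
  have d2: "real (card (W {1, 2} \<union> W {1, 3})) = 2 / (xi n u v)\<^sup>2 \<and>
      (\<forall>S\<in>W {1, 2} \<union> W {1, 3}. aliasing_index n u v S = xi n u v) \<and>
      half_lengths (W {1, 2} \<union> W {1, 3}) (ell9 n u v + 2) (ell10 n u v + 2)"
    if "lam5 n u v + lam6 n u v > 0"
  proof -
    have "{j \<in> {1..n}. odd (u j) \<and> odd (v j)} \<noteq> {}"
      using eqs(4) that by (metis card.empty less_irrefl)
    then obtain j where j: "j \<in> {1..n}" "odd (u j)" "odd (v j)"
      by blast
    note mixed = mixed_head_words_odd[where n = n and u = u and v = v, OF j, folded W_def, unfolded eqs(1-10), folded xi_def]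
    have "lam1 n u v + lam2 n u v + lam3 n u v + lam4 n u v +
        2 * (lam5 n u v + lam7 n u v + lam8 n u v) + 2 = ell9 n u v + 2"
      "lam1 n u v + lam2 n u v + lam3 n u v + lam4 n u v +
        2 * (lam6 n u v + lam7 n u v + lam8 n u v) + 2 = ell10 n u v + 2"
      by (simp_all add: ell9_def ell10_def)
    note mixed = mixed[unfolded this]
    then show ?thesis
      using pos by (simp add: nonzero_eq_divide_eq)
  qed
  have "D1_words n u v = (W {1} \<union> W {1, 2, 3}) \<union> (W {2} \<union> W {3}) \<union> W {2, 3} \<union> (W {1, 2} \<union> W {1, 3})"
    unfolding W_def by (rule D1_words_eq_heads)
  \<comment> \<open>A criterion that simplification can evaluate and that separates any two leading
    sets from different classes.\<close>
  moreover have "W H \<inter> W H' = {}" if "card H \<noteq> card H' \<or> 2 \<in> H \<and> 2 \<notin> H' \<or> 1 \<in> H \<and> 1 \<notin> H' \<or> 1 \<in> H' \<and> 1 \<notin> H" for H H'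
    using that by (intro disj) auto
  ultimately show ?thesis
    using a b W23 d1 d2
    by (intro exI[of _ "W {1} \<union> W {1, 2, 3}"] exI[of _ "W {2} \<union> W {3}"] exI[of _ "W {2, 3}"]
        exI[of _ "W {1, 2} \<union> W {1, 3}"]) (simp add: Int_Un_distrib Int_Un_distrib2)
qed

end
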